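(* Let $n\in\mathbb{N}$. If $\mathcal{L}$ is a finite set of rectangular polyominoes all of unit height, then $$\beta_n(\mathcal{L})\le\max\Big(2,\ \frac{3}{8}\,\omega^n\,\operatorname{lcm}\{w\mid w\in w(\mathcal{L})\}^2\Big),$$ where $\omega$ is the maximum width of any polyomino in $\mathcal{L}$.
   Context: $w(\mathcal{L})=\{k\mid \text{the }1\times k\text{ polyomino (height }1\text{, width }k)\text{ is in }\mathcal{L}\}$. $R_{n\times m}$ denotes the rectangular region of height $n$ and width $m$. A tiling of $R_{n\times m}$ by a multiset $T$ of polyominoes is a placement of translates of all elements of $T$ in $R_{n\times m}$ covering every point, with no two different elements having two-dimensional overlap; a tiling by elements of $\mathcal{L}$ is a tiling by a multiset with elements drawn from $\mathcal{L}$. A rearrangement of a tiling by $T$ is any tiling of $R_{n\times m}$ by the same multiset $T$. A tiling of $R_{n\times m}$ admits a subtiling if it has a rearrangement which is the side-by-side juxtaposition of a tiling of $R_{n\times m'}$ and a tiling of $R_{n\times m''}$ with $m=m'+m''$, $m',m''\neq 0$. $\beta_n(\mathcal{L})$ is the smallest natural number such that every tiling of $R_{n\times m}$ by elements of $\mathcal{L}$ with $m>\beta_n(\mathcal{L})$ admits a subtiling, and $\infty$ if no such number exists. *)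

theory Defs
  imports "HOL-Analysis.Analysis"
begin

text \<open>
  Polyominoes are subsets of the plane, the first coordinate being horizontal. A polyomino matters
  only up to translation, so a set of polyominoes may contain any representative of each class.
\<close>

type_synonym plane = "real \<times> real"

definition region :: "nat \<Rightarrow> nat \<Rightarrow> plane set" where
  "region n m = {0..real m} \<times> {0..real n}"

definition translate :: "plane \<Rightarrow> plane set \<Rightarrow> plane set" where
  "translate v P = (\<lambda>x. v + x) ` P"

definition rect_polyomino :: "nat \<Rightarrow> nat \<Rightarrow> plane set \<Rightarrow> bool" where
  "rect_polyomino h k P \<longleftrightarrow> h \<ge> 1 \<and> k \<ge> 1 \<and> (\<exists>v. P = translate v (region h k))"

definition widths :: "plane set set \<Rightarrow> nat set" where
  "widths L = {k. \<exists>P\<in>L. rect_polyomino 1 k P}"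

definition max_width :: "plane set set \<Rightarrow> nat" where
  "max_width L = Max {k. \<exists>P\<in>L. \<exists>h. rect_polyomino h k P}"

text \<open>
  A placement is a set of pairs of a tile and the vector by which it is translated. Using a set of
  pairs (rather than a multiset) loses nothing: two copies of one polyomino placed at the same
  position would overlap.
\<close>

type_synonym placement = "(plane set \<times> plane) set"

definition is_tiling :: "nat \<Rightarrow> nat \<Rightarrow> plane set multiset \<Rightarrow> placement \<Rightarrow> bool" where
  "is_tiling n m T S \<longleftrightarrow>
     finite S \<and> image_mset fst (mset_set S) = T \<and>
     (\<Union>(P, v)\<in>S. translate v P) = region n m \<and>
     (\<forall>(P, v)\<in>S. \<forall>(Q, u)\<in>S. (P, v) \<noteq> (Q, u) \<longrightarrow>
        interior (translate v P \<inter> translate u Q) = {})"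

definition is_tiling_from :: "nat \<Rightarrow> nat \<Rightarrow> plane set set \<Rightarrow> placement \<Rightarrow> bool" where
  "is_tiling_from n m L S \<longleftrightarrow> (\<exists>T. set_mset T \<subseteq> L \<and> is_tiling n m T S)"

definition rearrangement :: "nat \<Rightarrow> nat \<Rightarrow> placement \<Rightarrow> placement \<Rightarrow> bool" where
  "rearrangement n m S S' \<longleftrightarrow> (\<exists>T. is_tiling n m T S \<and> is_tiling n m T S')"

definition juxtapose :: "nat \<Rightarrow> placement \<Rightarrow> placement \<Rightarrow> placement" where
  "juxtapose m' S1 S2 = S1 \<union> (\<lambda>(P, v). (P, (real m', 0) + v)) ` S2"

definition admits_subtiling :: "nat \<Rightarrow> nat \<Rightarrow> placement \<Rightarrow> bool" where
  "admits_subtiling n m S \<longleftrightarrow>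
     (\<exists>m' m'' S1 S2 T1 T2.
        m = m' + m'' \<and> m' \<noteq> 0 \<and> m'' \<noteq> 0 \<and>
        is_tiling n m' T1 S1 \<and> is_tiling n m'' T2 S2 \<and>
        rearrangement n m S (juxtapose m' S1 S2))"

definition subtiling_bound :: "nat \<Rightarrow> plane set set \<Rightarrow> nat \<Rightarrow> bool" where
  "subtiling_bound n L b \<longleftrightarrow>
     (\<forall>m>b. \<forall>S. is_tiling_from n m L S \<longrightarrow> admits_subtiling n m S)"

definition beta :: "nat \<Rightarrow> plane set set \<Rightarrow> enat" where
  "beta n L = (if \<exists>b. subtiling_bound n L b then enat (LEAST b. subtiling_bound n L b) else \<infinity>)"

end

theory Submission
  imports Defs
begin

text \<open>
  Bricks in a tiling rest on the ground or on other bricks, so they lie in \<open>n\<close> rows, and the widths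
  in each row add up to \<open>m\<close>. Write \<open>l\<close> for the least common multiple of the widths. A row with fewer
  than \<open>l / w\<close> bricks of each width \<open>w\<close> has length at most the sum of the numbers \<open>l - w\<close>. So in a
  longer tiling every row contains \<open>l / w\<close> bricks of some width \<open>w\<close>; moving these to the front of
  each row splits off a tiling of width \<open>l\<close>. This bound is at most linear in \<open>l\<close>, and it is below the
  quadratic one as soon as \<open>l \<ge> 3\<close>.
\<close>

section \<open>Bricks\<close>

definition brick :: "plane \<Rightarrow> nat \<Rightarrow> plane set" where
  "brick p k = {fst p..fst p + real k} \<times> {snd p..snd p + 1}"

lemma translate_Times_Icc:
  "translate v ({a..b} \<times> {c..d}) = {fst v + a..fst v + b} \<times> {snd v + c..snd v + d}"
proof -
  have "x \<in> translate v ({a..b} \<times> {c..d})"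
    if "x \<in> {fst v + a..fst v + b} \<times> {snd v + c..snd v + d}" for x
    unfolding translate_def using that by (intro image_eqI[of _ _ "x - v"]) (auto simp: mem_Times_iff)
  moreover have "x \<in> {fst v + a..fst v + b} \<times> {snd v + c..snd v + d}"
    if "x \<in> translate v ({a..b} \<times> {c..d})" for x
    using that unfolding translate_def by (auto simp: mem_Times_iff)
  ultimately show ?thesis by blast
qed

lemma translate_region_1: "translate v (region 1 k) = brick v k"
  unfolding region_def translate_Times_Icc brick_def by simp

lemma translate_brick: "translate v (brick p k) = brick (v + p) k"
  unfolding brick_def translate_Times_Icc by (simp add: add.assoc)

lemma translate_translate: "translate u (translate v P) = translate (u + v) P"
  by (auto simp: translate_def image_image add.assoc)

lemma interior_translate: "interior (translate v P) = translate v (interior P)"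
  unfolding translate_def by (rule interior_translation)

lemma translate_Int: "translate v (P \<inter> Q) = translate v P \<inter> translate v Q"
  unfolding translate_def by (rule image_Int) (simp add: inj_def)

text \<open>If all four inequalities fail, the intersection is a rectangle with positive sides, so
  its centre is interior to both bricks. This turns topological non-overlap into inequalities
  between coordinates.\<close>

lemma interior_brick_Int_empty:
  assumes "interior (brick p j \<inter> brick q k) = {}" and "j \<ge> 1" "k \<ge> 1"
  shows "fst p + j \<le> fst q \<or> fst q + k \<le> fst p \<or> snd p + 1 \<le> snd q \<or> snd q + 1 \<le> snd p"
proof (rule ccontr)
  assume *: "\<not> ?thesis"
  \<comment> \<open>\<open>(?x, ?y)\<close> is the centre of the overlap rectangle.\<close>
  let ?x = "(max (fst p) (fst q) + min (fst p + j) (fst q + k)) / 2"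
  let ?y = "(max (snd p) (snd q) + min (snd p + 1) (snd q + 1)) / 2"
  have "(?x, ?y) \<in> interior (brick p j) \<inter> interior (brick q k)"
    using * assms(2,3) by (auto simp: brick_def interior_Times max_def min_def field_simps)
  then show False using assms(1) by (metis empty_iff interior_Int)
qed

text \<open>A brick with positive sides cannot be separated from itself in any of the four
  directions.\<close>

lemma interior_brick_nonempty: "k \<ge> 1 \<Longrightarrow> interior (brick p k) \<noteq> {}"
  using interior_brick_Int_empty[of p k p k] by auto

text \<open>Projecting to the horizontal axis leaves an interval whose length is the width. This
  makes \<open>width\<close> well defined and lets \<open>max_width\<close>, which ranges over all
  heights, be compared with \<open>widths\<close>.\<close>

lemma rect_polyomino_width_unique:
  assumes "rect_polyomino h k P" "rect_polyomino h' k' P"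
  shows "k = k'"
proof -
  have fst_eq: "\<exists>a. fst ` Q = {a..a + real j}" if Q: "rect_polyomino i j Q" for i j Q
  proof -
    obtain v where "Q = {fst v..fst v + real j} \<times> {snd v..snd v + real i}"
      using Q unfolding rect_polyomino_def region_def by (auto simp: translate_Times_Icc)
    then show ?thesis by (simp add: fst_image_times)
  qed
  obtain a b where "{a..a + real k} = {b..b + real k'}"
    using fst_eq[OF assms(1)] fst_eq[OF assms(2)] by metis
  then show ?thesis by (auto simp: Icc_eq_Icc)
qed

definition unit_height :: "plane set \<Rightarrow> bool" where
  "unit_height P \<longleftrightarrow> (\<exists>k. rect_polyomino 1 k P)"

definition width :: "plane set \<Rightarrow> nat" where
  "width P = (THE k. rect_polyomino 1 k P)"

text \<open>A polyomino may be any representative of its translation class, so the vector of a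
  placement need not be the position of the brick; adding \<open>corner P\<close> gives its lower
  left corner.\<close>

definition corner :: "plane set \<Rightarrow> plane" where
  "corner P = (SOME p. P = brick p (width P))"

lemma width_eq: "rect_polyomino 1 k P \<Longrightarrow> width P = k"
  unfolding width_def by (blast intro: the_equality rect_polyomino_width_unique)

lemma
  assumes "unit_height P"
  shows width_pos: "width P \<ge> 1" and brick_corner: "P = brick (corner P) (width P)"
proof -
  obtain k where k: "rect_polyomino 1 k P" using assms by (auto simp only: unit_height_def)
  then have w: "width P = k" by (rule width_eq)
  show "width P \<ge> 1" using k w by (simp add: rect_polyomino_def)
  have "\<exists>p. P = brick p (width P)"
    using k w unfolding rect_polyomino_def translate_region_1 by auto
  then show "P = brick (corner P) (width P)" unfolding corner_def by (rule someI_ex)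
qed

lemma translate_unit_height: "unit_height P \<Longrightarrow> translate v P = brick (v + corner P) (width P)"
  using brick_corner translate_brick by metis


section \<open>Rows of a brick tiling\<close>

text \<open>Any point between \<open>c\<close> and the largest element of \<open>F\<close> below
  \<open>c\<close> will do. It provides a height below the bottom of a brick but above all lower
  brick tops.\<close>

lemma ex_left_gap:
  fixes c :: real
  assumes "finite F"
  shows "\<exists>y<c. \<forall>z\<in>F. z < c \<longrightarrow> z < y"
proof (cases "{z\<in>F. z < c} = {}")
  case True
  then show ?thesis by (intro exI[of _ "c - 1"]) auto
next
  case False
  have fin: "finite {z\<in>F. z < c}" using assms by simp
  then have "Max {z\<in>F. z < c} < c" using Max_in[OF _ False] by auto
  then obtain y where y: "Max {z\<in>F. z < c} < y" "y < c" using dense by blast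
  have "z < y" if "z \<in> F" "z < c" for z
    using Max_ge[OF fin, of z] y(1) that by simp
  then show ?thesis using y(2) by blast
qed

lemma ex_in_open_interval_avoiding:
  fixes a b :: real
  assumes "finite F" "a < b"
  shows "\<exists>x. a < x \<and> x < b \<and> x \<notin> F"
proof -
  have "infinite ({a<..<b} - F)" using assms by (simp add: Diff_infinite_finite)
  then obtain x where "x \<in> {a<..<b} - F" using infinite_imp_nonempty by blast
  then show ?thesis by auto
qed

text \<open>The geometry is stated for an indexed family of bricks given by corner and width, so
  that equal bricks stay distinguishable and representatives and translation vectors
  disappear.\<close>

locale brick_tiling =
  fixes I :: "'i set" and p :: "'i \<Rightarrow> plane" and k :: "'i \<Rightarrow> nat" and n m :: nat
  assumes finite_I: "finite I"
    and width_ge_1: "i \<in> I \<Longrightarrow> k i \<ge> 1"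
    and cover: "(\<Union>i\<in>I. brick (p i) (k i)) = region n m"
    and disjoint: "\<lbrakk>i \<in> I; j \<in> I; i \<noteq> j\<rbrakk> \<Longrightarrow>
      interior (brick (p i) (k i) \<inter> brick (p j) (k j)) = {}"
begin

lemma separated:
  assumes "i \<in> I" "j \<in> I" "i \<noteq> j"
  shows "fst (p i) + k i \<le> fst (p j) \<or> fst (p j) + k j \<le> fst (p i) \<or>
    snd (p i) + 1 \<le> snd (p j) \<or> snd (p j) + 1 \<le> snd (p i)"
  using interior_brick_Int_empty[OF disjoint[OF assms]] assms width_ge_1 by blast

lemma bounds:
  assumes "i \<in> I"
  shows "0 \<le> fst (p i)" "fst (p i) + k i \<le> m" "0 \<le> snd (p i)" "snd (p i) + 1 \<le> n"
proof -
  have "brick (p i) (k i) \<subseteq> region n m" using cover assms by blast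
  moreover have "p i \<in> brick (p i) (k i)" "p i + (real (k i), 1) \<in> brick (p i) (k i)"
    by (auto simp: brick_def mem_Times_iff)
  ultimately have "p i \<in> region n m" "p i + (real (k i), 1) \<in> region n m" by blast+
  then show "0 \<le> fst (p i)" "fst (p i) + k i \<le> m" "0 \<le> snd (p i)" "snd (p i) + 1 \<le> n"
    by (auto simp: region_def mem_Times_iff)
qed

text \<open>A generic point just below a brick that rests above the ground lies in a brick whose top
  supports it.\<close>

lemma supporting_brick:
  assumes "i \<in> I" "snd (p i) > 0"
  shows "\<exists>j\<in>I. snd (p j) + 1 = snd (p i)"
proof -
  let ?X = "(\<lambda>j. fst (p j)) ` I \<union> (\<lambda>j. fst (p j) + k j) ` I"
  obtain x where x: "fst (p i) < x" "x < fst (p i) + k i" "x \<notin> ?X"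
    using ex_in_open_interval_avoiding[of ?X "fst (p i)" "fst (p i) + k i"]
      finite_I width_ge_1[OF assms(1)] by auto
  \<comment> \<open>Including 0 among the avoided heights forces \<open>y > 0\<close>, which keeps
    the point \<open>(x, y)\<close> inside the region.\<close>
  obtain y where y: "y < snd (p i)" "\<forall>z\<in>insert 0 ((\<lambda>j. snd (p j) + 1) ` I). z < snd (p i) \<longrightarrow> z < y"
    using ex_left_gap[of "insert 0 ((\<lambda>j. snd (p j) + 1) ` I)" "snd (p i)"] finite_I by auto
  have "(x, y) \<in> region n m"
    using x y assms bounds[OF assms(1)] by (auto simp: region_def)
  then obtain j where j: "j \<in> I" "(x, y) \<in> brick (p j) (k j)"
    using cover by blast
  then have *: "fst (p j) \<le> x" "x \<le> fst (p j) + k j" "snd (p j) \<le> y" "y \<le> snd (p j) + 1"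
    by (auto simp: brick_def)
  moreover have "x \<noteq> fst (p j)" "x \<noteq> fst (p j) + k j" using x(3) j(1) by auto
  moreover have "i \<noteq> j" using * y(1) by auto
  \<comment> \<open>Both bricks extend over the abscissa \<open>x\<close>, which rules out
    horizontal separation, and brick \<open>j\<close> starts at or below \<open>y\<close>, hence it
    cannot lie above brick \<open>i\<close>.\<close>
  ultimately have "snd (p j) + 1 \<le> snd (p i)"
    using separated[OF assms(1) j(1)] x y(1) by auto
  \<comment> \<open>A top strictly below \<open>snd (p i)\<close> would lie below \<open>y\<close>
    by the choice of \<open>y\<close>, but brick \<open>j\<close> reaches up to
    \<open>y\<close>.\<close>
  moreover have "\<not> snd (p j) + 1 < snd (p i)"
    using y(2) j(1) *(4) by fastforce
  ultimately show ?thesis using j(1) by force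
qed

text \<open>Passing to a supporting brick lowers the height by exactly 1, and the descent ends on
  the ground. The induction runs on the floor because the height is so far only a nonnegative
  real.\<close>

lemma height_in_Nats: "i \<in> I \<Longrightarrow> snd (p i) \<in> \<nat>"
proof (induction "nat \<lfloor>snd (p i)\<rfloor>" arbitrary: i rule: less_induct)
  case less
  show ?case
  proof (cases "snd (p i) > 0")
    case True
    then obtain j where j: "j \<in> I" "snd (p j) + 1 = snd (p i)"
      using supporting_brick less.prems by blast
    have "\<lfloor>snd (p i)\<rfloor> = \<lfloor>snd (p j)\<rfloor> + 1" using j(2) by (metis floor_add_int of_int_1)
    moreover have "\<lfloor>snd (p j)\<rfloor> \<ge> 0" using bounds(3)[OF j(1)] by simp
    ultimately have "snd (p j) \<in> \<nat>" using less.hyps[OF _ j(1)] by simp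
    then show ?thesis using j(2) by (metis Nats_1 Nats_add)
  next
    case False
    then have "snd (p i) = 0" using bounds(3)[OF less.prems] by simp
    then show ?thesis by simp
  qed
qed

definition row :: "nat \<Rightarrow> 'i set" where
  "row r = {i\<in>I. snd (p i) = r}"

lemma row_subset: "row r \<subseteq> I"
  by (auto simp: row_def)

lemma finite_row: "finite (row r)"
  using finite_subset[OF row_subset finite_I] .

lemma Union_row: "(\<Union>r<n. row r) = I"
proof -
  have "\<exists>r<n. i \<in> row r" if i: "i \<in> I" for i
  proof -
    obtain r where "snd (p i) = real r" using height_in_Nats[OF i] by (rule Nats_cases)
    moreover from this have "r < n" using bounds(4)[OF i] by linarith
    ultimately show ?thesis using i unfolding row_def by blast
  qed
  then show ?thesis using row_subset by blast
qed

text \<open>The projections of the bricks of a row cover \<open>{0..real m}\<close> and meet in at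
  most finitely many points, so comparing Lebesgue measures gives the sum of the widths.\<close>

lemma row_width:
  assumes "r < n"
  shows "(\<Sum>i\<in>row r. k i) = m"
proof -
  let ?J = "\<lambda>i. {fst (p i)..fst (p i) + real (k i)}"
  have "(\<Union>i\<in>row r. ?J i) = {0..real m}"
  proof (intro equalityI subsetI)
    fix x assume "x \<in> (\<Union>i\<in>row r. ?J i)"
    then show "x \<in> {0..real m}" using bounds(1,2) by (fastforce simp: row_def)
  next
    fix x assume "x \<in> {0..real m}"
    \<comment> \<open>Brick heights are integers, so a point at half-integer height
      \<open>r + 1/2\<close> can only be covered by a brick of row \<open>r\<close>.\<close>
    then have "(x, real r + 1/2) \<in> region n m" using assms by (auto simp: region_def)
    then obtain i where i: "i \<in> I" "(x, real r + 1/2) \<in> brick (p i) (k i)"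
      using cover by blast
    obtain s where s: "snd (p i) = real s" using height_in_Nats[OF i(1)] by (auto elim: Nats_cases)
    then have "s = r" using i(2) by (auto simp: brick_def)
    then show "x \<in> (\<Union>i\<in>row r. ?J i)" using i s by (auto simp: row_def brick_def)
  qed
  moreover have "pairwise (\<lambda>i j. negligible (?J i \<inter> ?J j)) (row r)"
  proof (rule pairwiseI)
    fix i j assume ij: "i \<in> row r" "j \<in> row r" "i \<noteq> j"
    then have "fst (p i) + k i \<le> fst (p j) \<or> fst (p j) + k j \<le> fst (p i)"
      using separated[of i j] by (auto simp: row_def)
    \<comment> \<open>Separated intervals share at most an endpoint, which is then the left end of
      one of them.\<close>
    then have "?J i \<inter> ?J j \<subseteq> {fst (p i), fst (p j)}" by auto
    then show "negligible (?J i \<inter> ?J j)"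
      by (rule negligible_subset[rotated]) (simp add: negligible_finite)
  qed
  ultimately have "measure lebesgue {0..real m} = (\<Sum>i\<in>row r. measure lebesgue (?J i))"
    using measure_negligible_finite_Union_image[OF finite_row, of r ?J] by simp
  then have "real m = (\<Sum>i\<in>row r. real (k i))" by simp
  then show ?thesis by (simp flip: of_nat_sum)
qed

end


section \<open>Building tilings\<close>

text \<open>This is \<open>is_tiling\<close> for an arbitrary area: the construction passes through
  single bricks, rows and translated rectangles.\<close>

definition tiles :: "plane set \<Rightarrow> plane set multiset \<Rightarrow> placement \<Rightarrow> bool" where
  "tiles A T S \<longleftrightarrow>
     finite S \<and> image_mset fst (mset_set S) = T \<and>
     (\<Union>(P, v)\<in>S. translate v P) = A \<and>
     (\<forall>(P, v)\<in>S. \<forall>(Q, u)\<in>S. (P, v) \<noteq> (Q, u) \<longrightarrow>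
        interior (translate v P \<inter> translate u Q) = {})"

lemma is_tiling_iff_tiles: "is_tiling n m = tiles (region n m)"
  by (intro ext) (simp add: is_tiling_def tiles_def)

lemma tiles_mem:
  assumes "tiles A T S" "(P, v) \<in> S"
  shows "P \<in># T" "translate v P \<subseteq> A"
proof -
  have T: "set_mset T = fst ` S"
    using assms(1) unfolding tiles_def by (metis finite_set_mset_mset_set set_image_mset)
  show "P \<in># T" unfolding T using assms(2) by (rule image_eqI[rotated]) simp
  have A: "A = (\<Union>(P, v)\<in>S. translate v P)" using assms(1) by (simp add: tiles_def)
  show "translate v P \<subseteq> A" unfolding A using assms(2) by blast
qed

lemma tiles_disjoint:
  assumes "tiles A T S" "(P, v) \<in> S" "(Q, u) \<in> S" "(P, v) \<noteq> (Q, u)"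
  shows "interior (translate v P \<inter> translate u Q) = {}"
proof -
  have "\<forall>i\<in>S. \<forall>j\<in>S. i \<noteq> j \<longrightarrow>
      interior (translate (snd i) (fst i) \<inter> translate (snd j) (fst j)) = {}"
    using assms(1) unfolding tiles_def case_prod_unfold prod.collapse by (elim conjE)
  from this[rule_format, OF assms(2-4)] show ?thesis by (simp only: fst_conv snd_conv)
qed

lemma tilesI:
  assumes "finite S" "image_mset fst (mset_set S) = T" "(\<Union>(P, v)\<in>S. translate v P) = A"
    and "\<And>P v Q u. \<lbrakk>(P, v) \<in> S; (Q, u) \<in> S; (P, v) \<noteq> (Q, u)\<rbrakk> \<Longrightarrow>
      interior (translate v P \<inter> translate u Q) = {}"
  shows "tiles A T S"
proof -
  have "\<forall>(P, v)\<in>S. \<forall>(Q, u)\<in>S. (P, v) \<noteq> (Q, u) \<longrightarrow>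
      interior (translate v P \<inter> translate u Q) = {}"
    unfolding case_prod_unfold
  proof (intro ballI impI)
    fix i j assume "i \<in> S" "j \<in> S" "(fst i, snd i) \<noteq> (fst j, snd j)"
    then show "interior (translate (snd i) (fst i) \<inter> translate (snd j) (fst j)) = {}"
      using assms(4)[of "fst i" "snd i" "fst j" "snd j"] unfolding prod.collapse by blast
  qed
  then show ?thesis using assms(1-3) unfolding tiles_def by (intro conjI)
qed

text \<open>Placements are sets, so the multisets add up only if no tile belongs to both. A common
  tile would lie in \<open>A \<inter> A'\<close>, although a unit-height tile has nonempty
  interior.\<close>

lemma tiles_Un:
  assumes S: "tiles A T S" and S': "tiles A' T' S'"
    and AA': "interior (A \<inter> A') = {}" and T: "\<And>P. P \<in># T \<Longrightarrow> unit_height P"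
  shows "tiles (A \<union> A') (T + T') (S \<union> S')"
proof -
  have cross: "interior (translate v P \<inter> translate u Q) = {}"
    if "(P, v) \<in> S" "(Q, u) \<in> S'" for P v Q u
    using tiles_mem(2)[OF S that(1)] tiles_mem(2)[OF S' that(2)] AA'
      interior_mono[of "translate v P \<inter> translate u Q" "A \<inter> A'"] by blast
  have "S \<inter> S' = {}"
  proof (rule ccontr)
    assume "S \<inter> S' \<noteq> {}"
    then obtain P v where Pv: "(P, v) \<in> S" "(P, v) \<in> S'" by auto
    then have "unit_height P" using T tiles_mem(1)[OF S] by blast
    then have "interior (translate v P) \<noteq> {}"
      using interior_brick_nonempty width_pos by (simp add: translate_unit_height)
    then show False using cross[OF Pv] by simp
  qed
  then have "mset_set (S \<union> S') = mset_set S + mset_set S'"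
    using S S' by (intro mset_set_Union) (auto simp: tiles_def)
  moreover have "interior (translate v P \<inter> translate u Q) = {}"
    if "(P, v) \<in> S \<union> S'" "(Q, u) \<in> S \<union> S'" "(P, v) \<noteq> (Q, u)" for P v Q u
    using that cross tiles_disjoint[OF S] tiles_disjoint[OF S'] by (metis Int_commute UnE)
  moreover have "finite (S \<union> S')" "(\<Union>(P, v)\<in>S \<union> S'. translate v P) = A \<union> A'"
    and "image_mset fst (mset_set S) = T" "image_mset fst (mset_set S') = T'"
    using S S' by (simp_all add: tiles_def UN_Un)
  ultimately show ?thesis by (intro tilesI) simp_all
qed

lemma tiles_translate:
  assumes "tiles A T S"
  shows "tiles (translate x A) T ((\<lambda>(P, v). (P, x + v)) ` S)"
proof -
  have inj: "inj_on (\<lambda>(P, v). (P, x + v)) S" by (auto simp: inj_on_def)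
  have "image_mset fst (mset_set ((\<lambda>(P, v). (P, x + v)) ` S))
      = image_mset (fst \<circ> (\<lambda>(P, v). (P, x + v))) (mset_set S)"
    using image_mset_mset_set[OF inj] by (metis multiset.map_comp)
  also have "fst \<circ> (\<lambda>(P, v). (P, x + v)) = (fst :: plane set \<times> plane \<Rightarrow> _)" by auto
  finally have "image_mset fst (mset_set ((\<lambda>(P, v). (P, x + v)) ` S)) = T"
    using assms by (simp add: tiles_def)
  moreover have "(\<Union>(P, v)\<in>(\<lambda>(P, v). (P, x + v)) ` S. translate v P) = translate x A"
  proof -
    have "(\<Union>(P, v)\<in>(\<lambda>(P, v). (P, x + v)) ` S. translate v P)
        = (\<Union>(P, v)\<in>S. translate x (translate v P))"
      by (force simp: translate_translate)
    also have "\<dots> = translate x (\<Union>(P, v)\<in>S. translate v P)"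
      by (auto simp: translate_def)
    finally show ?thesis using assms by (simp add: tiles_def)
  qed
  moreover have "interior (translate v P \<inter> translate u Q) = {}"
    if Pv: "(P, v) \<in> (\<lambda>(P, v). (P, x + v)) ` S" and Qu: "(Q, u) \<in> (\<lambda>(P, v). (P, x + v)) ` S"
      and ne: "(P, v) \<noteq> (Q, u)" for P v Q u
  proof -
    obtain v' u' where vu: "v = x + v'" "u = x + u'" and S: "(P, v') \<in> S" "(Q, u') \<in> S"
      using Pv Qu by auto
    have "(P, v') \<noteq> (Q, u')" using ne vu by blast
    then have "interior (translate v' P \<inter> translate u' Q) = {}"
      using tiles_disjoint[OF assms S] by blast
    then have "interior (translate x (translate v' P \<inter> translate u' Q)) = {}"
      unfolding interior_translate by (simp add: translate_def)
    then show ?thesis by (simp only: vu translate_Int translate_translate)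
  qed
  moreover have "finite ((\<lambda>(P, v). (P, x + v)) ` S)" using assms by (simp add: tiles_def)
  ultimately show ?thesis by (intro tilesI)
qed

lemma tiles_single:
  assumes "unit_height P"
  shows "tiles (brick q (width P)) {#P#} {(P, q - corner P)}"
  using assms by (simp add: tiles_def translate_unit_height)

lemma brick_Un: "brick q j \<union> brick (q + (real j, 0)) k = brick q (j + k)"
  by (auto simp: brick_def)

text \<open>The bricks are laid side by side, each new one to the left of the others, so the
  position \<open>q\<close> varies in the induction. The induction starts from one brick because
  \<open>brick q 0\<close> is a segment, which the empty placement does not cover.\<close>

lemma ex_tiles_row:
  assumes "finite A" "A \<noteq> {}" "\<And>a. a \<in> A \<Longrightarrow> unit_height (g a)"
  shows "\<exists>S. tiles (brick q (\<Sum>a\<in>A. width (g a))) (image_mset g (mset_set A)) S"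
  using assms
proof (induction arbitrary: q rule: finite_ne_induct)
  case (singleton a)
  then have "unit_height (g a)" by simp
  from tiles_single[OF this, of q] show ?case by auto
next
  case (insert a A)
  let ?w = "width (g a)" and ?W = "\<Sum>a\<in>A. width (g a)"
  let ?q = "q + (real ?w, 0)"
  obtain S where S: "tiles (brick ?q ?W) (image_mset g (mset_set A)) S"
    using insert.IH insert.prems by blast
  have "interior (brick q ?w \<inter> brick ?q ?W) = {}"
    by (auto simp: brick_def interior_Times simp flip: Times_Int_Times)
  then have "tiles (brick q ?w \<union> brick ?q ?W) ({#g a#} + image_mset g (mset_set A))
      ({(g a, q - corner (g a))} \<union> S)"
    using tiles_Un[OF tiles_single S] insert.prems by auto
  moreover have "brick q ?w \<union> brick ?q ?W = brick q (?w + ?W)"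
    by (rule brick_Un)
  ultimately show ?case using insert.hyps by auto
qed

lemma region_Suc: "n \<ge> 1 \<Longrightarrow> region n m \<union> brick (0, real n) m = region (Suc n) m"
  by (auto simp: region_def brick_def)

text \<open>Rows are stacked from the bottom, starting with one row since \<open>region 0 m\<close>
  is a nonempty segment. The sets \<open>A r\<close> contain indices rather than polyominoes,
  because a polyomino may be used repeatedly.\<close>

lemma ex_is_tiling:
  assumes "n \<ge> 1" "m \<ge> 1"
    and "\<And>r. r < n \<Longrightarrow> finite (A r)"
    and "\<And>r a. r < n \<Longrightarrow> a \<in> A r \<Longrightarrow> unit_height (g a)"
    and "\<And>r. r < n \<Longrightarrow> (\<Sum>a\<in>A r. width (g a)) = m"
  shows "\<exists>S. is_tiling n m (\<Sum>r<n. image_mset g (mset_set (A r))) S"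
proof -
  have ex_row: "\<exists>S. tiles (brick (0, real r) m) (image_mset g (mset_set (A r))) S" if "r < n" for r
  proof -
    \<comment> \<open>An empty row would have width 0, contradicting
      \<open>m \<ge> 1\<close>.\<close>
    have "A r \<noteq> {}" using assms(5)[OF that] assms(2) by auto
    then show ?thesis
      using ex_tiles_row[of "A r" g "(0, real r)"] assms(3,4,5) that by auto
  qed
  have "\<exists>S. is_tiling j m (\<Sum>r<j. image_mset g (mset_set (A r))) S" if "1 \<le> j" "j \<le> n" for j
    using that
  proof (induction j rule: nat_induct_at_least)
    case base
    then show ?case using ex_row[of 0] assms(1)
      by (simp add: is_tiling_iff_tiles region_def brick_def)
  next
    case (Suc j)
    obtain S S' where
      S: "tiles (region j m) (\<Sum>r<j. image_mset g (mset_set (A r))) S"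
      and S': "tiles (brick (0, real j) m) (image_mset g (mset_set (A j))) S'"
      using Suc ex_row[of j] by (auto simp: is_tiling_iff_tiles)
    have "interior (region j m \<inter> brick (0, real j) m) = {}"
      by (auto simp: region_def brick_def interior_Times simp flip: Times_Int_Times)
    moreover have "unit_height P" if "P \<in># (\<Sum>r<j. image_mset g (mset_set (A r)))" for P
      using that assms(3,4) Suc.prems by (auto simp: set_mset_sum Suc_le_eq dest: less_trans)
    ultimately have "tiles (region j m \<union> brick (0, real j) m)
        ((\<Sum>r<j. image_mset g (mset_set (A r))) + image_mset g (mset_set (A j))) (S \<union> S')"
      using tiles_Un[OF S S'] by blast
    then show ?case using region_Suc[OF Suc.hyps(1)] by (auto simp: is_tiling_iff_tiles)
  qed
  then show ?thesis using assms(1) by blast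
qed

lemma is_tiling_juxtapose:
  assumes S1: "is_tiling n m1 T1 S1" and S2: "is_tiling n m2 T2 S2"
    and T1: "\<And>P. P \<in># T1 \<Longrightarrow> unit_height P"
  shows "is_tiling n (m1 + m2) (T1 + T2) (juxtapose m1 S1 S2)"
proof -
  let ?R = "translate (real m1, 0) (region n m2)"
  have R: "?R = {real m1..real m1 + real m2} \<times> {0..real n}"
    by (simp add: region_def translate_Times_Icc)
  have "interior (region n m1 \<inter> ?R) = {}"
    unfolding R by (auto simp: region_def interior_Times)
  then have "tiles (region n m1 \<union> ?R) (T1 + T2) (juxtapose m1 S1 S2)"
    using tiles_Un[OF S1[unfolded is_tiling_iff_tiles]
        tiles_translate[OF S2[unfolded is_tiling_iff_tiles], of "(real m1, 0)"]] T1
    unfolding juxtapose_def by blast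
  moreover have "region n m1 \<union> ?R = region n (m1 + m2)"
    unfolding R by (auto simp: region_def)
  ultimately show ?thesis by (simp add: is_tiling_iff_tiles)
qed


section \<open>Splitting off a subtiling\<close>

text \<open>By pigeonhole some width \<open>w\<close> contributes more than \<open>l - w\<close> to
  the total. Its contribution is a multiple of \<open>w\<close>, hence at least \<open>l\<close>,
  and \<open>l / w\<close> of its copies sum to exactly \<open>l\<close>.\<close>

lemma ex_subset_sum_eq_common_multiple:
  fixes k :: "'a \<Rightarrow> nat" and l :: nat
  assumes "finite A" "finite W" "k ` A \<subseteq> W" and W: "\<And>w. w \<in> W \<Longrightarrow> w dvd l" and "l > 0"
    and large: "(\<Sum>w\<in>W. l - w) < (\<Sum>a\<in>A. k a)"
  shows "\<exists>U\<subseteq>A. (\<Sum>a\<in>U. k a) = l"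
proof -
  let ?A = "\<lambda>w. {a\<in>A. k a = w}"
  have "(\<Sum>a\<in>A. k a) = (\<Sum>w\<in>W. \<Sum>a\<in>?A w. k a)"
    using sum.group[OF assms(1-3)] by (rule sym)
  also have "\<dots> = (\<Sum>w\<in>W. w * card (?A w))"
    by (intro sum.cong) auto
  finally have "(\<Sum>w\<in>W. l - w) < (\<Sum>w\<in>W. w * card (?A w))" using large by simp
  then obtain w where w: "w \<in> W" "l - w < w * card (?A w)"
    by (meson leI not_le sum_mono)
  obtain d where d: "l = w * d" using W[OF w(1)] by blast
  have "w * (d - 1) < w * card (?A w)" using w(2) d by (simp add: diff_mult_distrib2)
  then have "d \<le> card (?A w)" by auto
  then obtain U where U: "U \<subseteq> ?A w" "card U = d" by (rule obtain_subset_with_card_n)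
  have "(\<Sum>a\<in>U. k a) = (\<Sum>a\<in>U. w)" using U(1) by (intro sum.cong) auto
  then show ?thesis using U d by (intro exI[of _ U]) auto
qed

section \<open>Tilings by a fixed finite set of unit-height polyominoes\<close>

locale unit_height_set =
  fixes L :: "plane set set"
  assumes finite_L: "finite L" and unit_height_L: "P \<in> L \<Longrightarrow> unit_height P"
begin

lemma widths_eq: "widths L = width ` L"
  using unit_height_L width_eq unfolding widths_def unit_height_def by (force simp: image_iff)

lemma finite_widths: "finite (widths L)"
  using finite_L by (simp add: widths_eq)

lemma Lcm_widths_pos: "Lcm (widths L) > 0"
proof -
  have "0 \<notin> widths L" by (auto simp: widths_def rect_polyomino_def)
  then show ?thesis using finite_widths by (metis Lcm_0_iff gr0I)
qed

lemma widths_subset: "widths L \<subseteq> {1..max_width L}"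
proof
  fix k assume k: "k \<in> widths L"
  \<comment> \<open>Finiteness of this set is what makes \<open>Max\<close> in
    \<open>max_width\<close> an upper bound.\<close>
  have "{k. \<exists>P\<in>L. \<exists>h. rect_polyomino h k P} \<subseteq> width ` L"
    using unit_height_L width_eq rect_polyomino_width_unique unfolding unit_height_def by blast
  then have "finite {k. \<exists>P\<in>L. \<exists>h. rect_polyomino h k P}"
    using finite_L finite_subset by blast
  then have "k \<le> max_width L"
    unfolding max_width_def using k by (intro Max_ge) (auto simp: widths_def)
  moreover have "k \<ge> 1" using k by (auto simp: widths_def rect_polyomino_def)
  ultimately show "k \<in> {1..max_width L}" by simp
qed

lemma brick_tiling_of_tiling:
  assumes "is_tiling n m T S" "set_mset T \<subseteq> L"
  shows "brick_tiling S (\<lambda>(P, v). v + corner P) (\<lambda>(P, v). width P) n m"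
proof -
  have fin: "finite S" using assms(1) by (simp add: is_tiling_def)
  have unit: "unit_height P" if "(P, v) \<in> S" for P v
    using assms(2) unit_height_L tiles_mem(1)[OF assms(1)[unfolded is_tiling_iff_tiles] that]
    by blast
  have brick: "translate v P = brick (v + corner P) (width P)" if "(P, v) \<in> S" for P v
    using translate_unit_height[OF unit[OF that]] .
  show ?thesis
  proof
    show "finite S" by (rule fin)
    show "(case i of (P, v) \<Rightarrow> width P) \<ge> 1" if "i \<in> S" for i
      using that unit[of "fst i" "snd i"] width_pos by (simp add: case_prod_unfold)
    have "(\<Union>(P, v)\<in>S. brick (v + corner P) (width P)) = (\<Union>(P, v)\<in>S. translate v P)"
      using brick by (intro SUP_cong) auto
    then show "(\<Union>i\<in>S. brick (case i of (P, v) \<Rightarrow> v + corner P) (case i of (P, v) \<Rightarrow> width P))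
        = region n m"
      using assms(1) by (simp add: is_tiling_def case_prod_unfold)
    show "interior (brick (case i of (P, v) \<Rightarrow> v + corner P) (case i of (P, v) \<Rightarrow> width P) \<inter>
        brick (case j of (P, v) \<Rightarrow> v + corner P) (case j of (P, v) \<Rightarrow> width P)) = {}"
      if "i \<in> S" "j \<in> S" "i \<noteq> j" for i j
    proof -
      obtain P v Q u where ij: "i = (P, v)" "j = (Q, u)" by (meson surj_pair)
      have "interior (translate v P \<inter> translate u Q) = {}"
        using that tiles_disjoint[OF assms(1)[unfolded is_tiling_iff_tiles]] unfolding ij by blast
      then show ?thesis using that brick by (simp add: ij)
    qed
  qed
qed

text \<open>The region contains the origin, so a tiling has at least one tile; that tile belongs to
  \<open>L\<close> and lies in one of the \<open>n\<close> rows. This settles the degenerate cases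
  of the theorem.\<close>

lemma no_tiling:
  assumes "n = 0 \<or> L = {}" "is_tiling_from n m L S"
  shows False
proof -
  obtain T where T: "is_tiling n m T S" "set_mset T \<subseteq> L"
    using assms(2) by (auto simp: is_tiling_from_def)
  interpret brick_tiling S "\<lambda>(P, v). v + corner P" "\<lambda>(P, v). width P" n m
    using brick_tiling_of_tiling[OF T] .
  have "(0, 0) \<in> region n m" by (simp add: region_def)
  then obtain i where i: "i \<in> S" using cover by blast
  then have "n \<noteq> 0" using Union_row by auto
  moreover have "fst i \<in># T" using T(1) i tiles_mem(1)[of _ T S "fst i" "snd i"]
    by (auto simp: is_tiling_iff_tiles)
  then have "L \<noteq> {}" using T(2) by auto
  ultimately show False using assms(1) by blast
qed

text \<open>The bound on the sum yields, in every row, a set of bricks of total width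
  \<open>Lcm (widths L)\<close>; the bound \<open>m > Lcm (widths L)\<close> leaves a remainder of
  positive width.\<close>

lemma admits_subtiling_of_large:
  assumes "is_tiling_from n m L S"
    and Lcm: "m > Lcm (widths L)" and sum: "m > (\<Sum>w\<in>widths L. Lcm (widths L) - w)"
  shows "admits_subtiling n m S"
proof -
  let ?l = "Lcm (widths L)"
  have n: "n \<ge> 1" using no_tiling[OF _ assms(1)] by (cases n) auto
  obtain T where T: "is_tiling n m T S" "set_mset T \<subseteq> L"
    using assms(1) by (auto simp: is_tiling_from_def)
  interpret brick_tiling S "\<lambda>(P, v). v + corner P" "\<lambda>(P, v). width P" n m
    using brick_tiling_of_tiling[OF T] .
  have TS: "T = image_mset fst (mset_set S)" using T(1) by (simp add: is_tiling_def)
  have fst_L: "fst i \<in> L" if "i \<in> S" for i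
    using that T(2) finite_I unfolding TS by auto
  have row_sum: "(\<Sum>i\<in>row r. width (fst i)) = m" if "r < n" for r
    using row_width[OF that] by (simp add: case_prod_unfold)
  have "\<exists>U\<subseteq>row r. (\<Sum>i\<in>U. width (fst i)) = ?l" if "r < n" for r
  proof (rule ex_subset_sum_eq_common_multiple[OF finite_row finite_widths _ _ Lcm_widths_pos])
    show "(\<lambda>i. width (fst i)) ` row r \<subseteq> widths L"
      using row_subset fst_L unfolding widths_eq by blast
    show "(\<Sum>w\<in>widths L. ?l - w) < (\<Sum>i\<in>row r. width (fst i))"
      using sum row_sum[OF that] by simp
  qed (rule dvd_Lcm)
  then obtain U where U: "\<And>r. r < n \<Longrightarrow> U r \<subseteq> row r"
    and U_sum: "\<And>r. r < n \<Longrightarrow> (\<Sum>i\<in>U r. width (fst i)) = ?l"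
    by metis
  have fin_U: "finite (U r)" if "r < n" for r
    using finite_subset[OF U[OF that] finite_row] .
  have rest_sum: "(\<Sum>i\<in>row r - U r. width (fst i)) = m - ?l" if "r < n" for r
    using U[OF that] U_sum[OF that] row_sum[OF that] fin_U[OF that]
    by (simp add: sum_diff_nat)
  have unit: "unit_height (fst i)" if "i \<in> row r" for i r
    using that row_subset fst_L unit_height_L by blast
  define T1 where "T1 = (\<Sum>r<n. image_mset fst (mset_set (U r)))"
  define T2 where "T2 = (\<Sum>r<n. image_mset fst (mset_set (row r - U r)))"
  have "\<exists>S1. is_tiling n ?l T1 S1"
    unfolding T1_def
  proof (rule ex_is_tiling[OF n _ fin_U _ U_sum])
    show "?l \<ge> 1" using Lcm_widths_pos by linarith
    show "unit_height (fst i)" if "r < n" "i \<in> U r" for r i using that U unit by blast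
  qed
  then obtain S1 where S1: "is_tiling n ?l T1 S1" by blast
  have "\<exists>S2. is_tiling n (m - ?l) T2 S2"
    unfolding T2_def
  proof (rule ex_is_tiling[OF n _ _ _ rest_sum])
    show "m - ?l \<ge> 1" using Lcm by linarith
    show "finite (row r - U r)" for r using finite_row by blast
    show "unit_height (fst i)" if "i \<in> row r - U r" for r i using that unit by blast
  qed
  then obtain S2 where S2: "is_tiling n (m - ?l) T2 S2" by blast
  \<comment> \<open>The rows partition the placement, and each row splits into \<open>U r\<close>
    and the rest. Hence \<open>T = T1 + T2\<close>, so the juxtaposition uses exactly the original
    tiles.\<close>
  have "mset_set S = (\<Sum>r<n. mset_set (row r))"
  proof -
    have "mset_set (\<Union>r<j. row r) = (\<Sum>r<j. mset_set (row r))" for j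
    proof (induction j)
      case (Suc j)
      have "(\<Union>r<j. row r) \<inter> row j = {}" by (auto simp: row_def)
      then show ?case using Suc finite_row
        by (simp add: lessThan_Suc Un_commute[of "row j"] mset_set_Union)
    qed simp
    then show ?thesis using Union_row by metis
  qed
  also have "\<dots> = (\<Sum>r<n. mset_set (U r) + mset_set (row r - U r))"
  proof (rule sum.cong)
    fix r assume "r \<in> {..<n}"
    then show "mset_set (row r) = mset_set (U r) + mset_set (row r - U r)"
      using U[of r] fin_U[of r] finite_row[of r]
      by (simp flip: mset_set_Union add: Un_absorb1)
  qed simp
  finally have "T = T1 + T2"
  proof -
    assume *: "mset_set S = (\<Sum>r<n. mset_set (U r) + mset_set (row r - U r))"
    have hom: "image_mset fst (\<Sum>r<j. M r) = (\<Sum>r<j. image_mset fst (M r))"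
      for j :: nat and M :: "nat \<Rightarrow> (plane set \<times> plane) multiset"
      by (induction j) auto
    show ?thesis unfolding TS * hom T1_def T2_def by (simp add: sum.distrib)
  qed
  then have "is_tiling n (?l + (m - ?l)) T (juxtapose ?l S1 S2)"
    using is_tiling_juxtapose[OF S1 S2] T(2) unit_height_L by auto
  then have "rearrangement n m S (juxtapose ?l S1 S2)"
    using T(1) Lcm unfolding rearrangement_def by auto
  moreover have "m = ?l + (m - ?l)" "?l \<noteq> 0" "m - ?l \<noteq> 0" using Lcm Lcm_widths_pos by auto
  ultimately show ?thesis using S1 S2 unfolding admits_subtiling_def by blast
qed

end

section \<open>Comparison with the quadratic bound\<close>

lemma beta_le: "subtiling_bound n L b \<Longrightarrow> beta n L \<le> enat b"
  unfolding beta_def by (auto intro: Least_le)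

theorem corollary5p12:
  fixes n :: nat and L :: "plane set set"
  assumes "finite L"
    and "\<And>P. P \<in> L \<Longrightarrow> \<exists>k. rect_polyomino 1 k P"
  shows "ereal_of_enat (beta n L)
    \<le> ereal (max 2 (3 / 8 * real (max_width L) ^ n * real (Lcm (widths L)) ^ 2))"
proof -
  interpret unit_height_set L
      using assms by unfold_locales (auto simp only: unit_height_def)
  let ?l = "Lcm (widths L)" and ?\<omega> = "max_width L"
  let ?B = "max 2 (3 / 8 * real ?\<omega> ^ n * real ?l ^ 2)"
  have "\<exists>b. subtiling_bound n L b \<and> real b \<le> ?B"
  proof (cases "n = 0 \<or> L = {}")
    case True
    then have "subtiling_bound n L 0" using no_tiling by (auto simp: subtiling_bound_def)
    then show ?thesis by (intro exI[of _ 0]) auto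
  next
    case False
    let ?s = "\<Sum>w\<in>widths L. ?l - w"
    have "subtiling_bound n L (max ?l ?s)"
      using admits_subtiling_of_large by (auto simp: subtiling_bound_def)
    moreover have "real (max ?l ?s) \<le> ?B"
    proof -
      have "widths L \<noteq> {}" using False by (simp add: widths_eq)
      then have \<omega>: "?\<omega> \<ge> 1" using widths_subset by fastforce
      have "card (widths L) \<le> ?\<omega>"
        using card_mono[OF _ widths_subset] by simp
      \<comment> \<open>There are at most \<open>?\<omega>\<close> widths, and each is at least
        1.\<close>
      have s: "?s \<le> ?\<omega> * (?l - 1)"
      proof -
        have "?s \<le> (\<Sum>w\<in>widths L. ?l - 1)"
          using widths_subset by (intro sum_mono) fastforce
        also have "\<dots> \<le> ?\<omega> * (?l - 1)"
          using \<open>card (widths L) \<le> ?\<omega>\<close> by simp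
        finally show ?thesis .
      qed
      show ?thesis
      \<comment> \<open>For \<open>?l \<ge> 3\<close> the factor 3/8 is absorbed, since 3/8 times
        \<open>?l\<close> is at least 9/8. For smaller \<open>?l\<close> the constant 2 in the
        maximum takes over.\<close>
      proof (cases "?l \<ge> 3")
        case True
        have "real (max ?l ?s) \<le> real (?\<omega> * ?l)"
        proof -
          have "?\<omega> * (?l - 1) \<le> ?\<omega> * ?l" "?l \<le> ?\<omega> * ?l" using \<omega> by auto
          then show ?thesis using s by (intro of_nat_mono) linarith
        qed
        also have "\<dots> = real ?\<omega> * real ?l" by simp
        also have "\<dots> \<le> real ?\<omega> ^ n * (3 / 8 * real ?l ^ 2)"
        proof (rule mult_mono)
          show "real ?\<omega> \<le> real ?\<omega> ^ n" using \<omega> False by (intro self_le_power) auto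
          have "3 * real ?l \<le> real ?l * real ?l" using True by (intro mult_right_mono) auto
          then show "real ?l \<le> 3 / 8 * real ?l ^ 2" by (simp add: power2_eq_square)
        qed auto
        finally show ?thesis by (simp add: mult_ac)
      next
        case l: False
        \<comment> \<open>The maximal width is itself a width, so it divides the least common
          multiple, which here is at most 2.\<close>
        have "?\<omega> \<le> ?l"
        proof -
          have "{k. \<exists>P\<in>L. \<exists>h. rect_polyomino h k P} = widths L"
            using assms(2) rect_polyomino_width_unique unfolding widths_def by blast
          then have "?\<omega> \<in> widths L"
            using Max_in[OF finite_widths \<open>widths L \<noteq> {}\<close>] by (simp add: max_width_def)
          then show ?thesis using Lcm_widths_pos by (intro dvd_imp_le) auto
        qed
        then have "?\<omega> * (?l - 1) \<le> 2 * 1" using l by (intro mult_le_mono) auto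
        then have "max ?l ?s \<le> 2" using s l by simp
        then have "real (max ?l ?s) \<le> 2" by (metis of_nat_le_iff of_nat_numeral)
        then show ?thesis by (rule order_trans) simp
      qed
    qed
    ultimately show ?thesis by blast
  qed
  then obtain b where b: "subtiling_bound n L b" "real b \<le> ?B" by blast
  have "ereal_of_enat (beta n L) \<le> ereal_of_enat (enat b)"
    using beta_le[OF b(1)] by (simp only: ereal_of_enat_le_iff)
  also have "\<dots> = ereal (real b)" by simp
  also have "\<dots> \<le> ereal ?B" using b(2) by (simp only: ereal_less_eq)
  finally show ?thesis .
qed

end
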